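(* For all integers $m,n\geq 0$, the lattice $\mathbf{W}(m,n)$ is interval-constructable.
   Context: An $(m,n)$-word is a word $\mathfrak{w}=w_1w_2\cdots w_n$ of length $n$ over the alphabet $\{0,1,\dots,m+1\}$ such that (MN1) $w_1\neq m+1$, and (MN2) for every $s$ with $1\le s\le m$ and every index $i$, if $w_i=s$ then $w_j\ge s$ for all $j<i$. $\mathbf{W}(m,n)$ is the set of $(m,n)$-words ordered componentwise ($\mathfrak{u}\le\mathfrak{v}$ iff $u_i\le v_i$ for all $i$); this is a lattice. For a poset $\mathbf{P}=(P,\le)$ and an interval $X=[p,q]\subseteq P$, let $P_{\le X}=\{x\in P: x\le y\text{ for some }y\in X\}$; the doubling of $\mathbf{P}$ by $X$ is the subposet of $\mathbf{P}\times\mathbf{2}$ (with $\mathbf 2$ the chain $1<2$, product order componentwise) induced on $(P_{\le X}\times\{1\})\cup(((P\setminus P_{\le X})\cup X)\times\{2\})$. A finite lattice is interval-constructable if it is isomorphic to a lattice obtained from the one-element lattice by a finite (possibly empty) sequence of interval doublings. *)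

theory Defs
  imports "HOL-Algebra.Lattice"
begin

text \<open>Letters are indexed from \<open>1\<close> in the mathematics and from \<open>0\<close> in lists, so the first
  letter is \<open>w ! 0\<close>. For \<open>n = 0\<close> only the empty word exists, and the condition on the first letter
  is void.\<close>

definition mn_word :: "nat \<Rightarrow> nat \<Rightarrow> nat list \<Rightarrow> bool" where
  "mn_word m n w \<longleftrightarrow>
     length w = n \<and> set w \<subseteq> {0..m + 1} \<and>
     (n \<ge> 1 \<longrightarrow> w ! 0 \<noteq> m + 1) \<and>
     (\<forall>s i. 1 \<le> s \<and> s \<le> m \<and> i < n \<and> w ! i = s \<longrightarrow> (\<forall>j<i. w ! j \<ge> s))"

definition W :: "nat \<Rightarrow> nat \<Rightarrow> nat list gorder" where
  "W m n = \<lparr> carrier = {w. mn_word m n w}, eq = (=), le = list_all2 (\<le>) \<rparr>"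

definition down_closure :: "'a gorder \<Rightarrow> 'a set \<Rightarrow> 'a set" where
  "down_closure P X = {x \<in> carrier P. \<exists>y\<in>X. x \<sqsubseteq>\<^bsub>P\<^esub> y}"

definition doubling :: "'a gorder \<Rightarrow> 'a set \<Rightarrow> ('a \<times> nat) gorder" where
  "doubling P X =
     \<lparr> carrier = down_closure P X \<times> {1} \<union> ((carrier P - down_closure P X) \<union> X) \<times> {2},
       eq = (=),
       le = (\<lambda>(x, i) (y, j). x \<sqsubseteq>\<^bsub>P\<^esub> y \<and> i \<le> j) \<rparr>"

definition order_image :: "('a \<Rightarrow> 'b) \<Rightarrow> 'a gorder \<Rightarrow> 'b gorder" where
  "order_image f P =
     \<lparr> carrier = f ` carrier P,
       eq = (=),
       le = (\<lambda>u v. \<exists>x\<in>carrier P. \<exists>y\<in>carrier P. u = f x \<and> v = f y \<and> x \<sqsubseteq>\<^bsub>P\<^esub> y) \<rparr>"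

text \<open>Each doubling changes the element type from \<open>'a\<close> to \<open>'a \<times> nat\<close>. The following type is closed
  under this operation (through the injective constructor \<open>Copy\<close>), so that doublings can be
  iterated; the type carries no mathematical content.\<close>

datatype tower = Point | Copy "tower \<times> nat"

inductive iterated_interval_doubling :: "tower gorder \<Rightarrow> bool" where
  one_element:
    "iterated_interval_doubling \<lparr> carrier = {Point}, eq = (=), le = (=) \<rparr>"
| double:
    "\<lbrakk> iterated_interval_doubling P; p \<in> carrier P; q \<in> carrier P; p \<sqsubseteq>\<^bsub>P\<^esub> q \<rbrakk>
     \<Longrightarrow> iterated_interval_doubling (order_image Copy (doubling P \<lbrace>p..q\<rbrace>\<^bsub>P\<^esub>))"

definition order_isomorphic :: "'a gorder \<Rightarrow> 'b gorder \<Rightarrow> bool" where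
  "order_isomorphic P Q \<longleftrightarrow>
     (\<exists>f. order_emb P Q f \<and> bij_betw f (carrier P) (carrier Q))"

definition interval_constructable :: "'a gorder \<Rightarrow> bool" where
  "interval_constructable L \<longleftrightarrow>
     finite (carrier L) \<and> Lattice.lattice L \<and>
     (\<exists>P. iterated_interval_doubling P \<and> order_isomorphic L P)"

end

theory Submission
  imports Defs
begin

text \<open>Append a last letter to the words of length \<open>n\<close>. For \<open>n > 0\<close> the letters \<open>0\<close> and \<open>m + 1\<close>
  can always be appended, so admitting only these two doubles all of \<open>W m n\<close>. The letters
  \<open>1, \<dots>, m\<close> are then admitted one at a time: \<open>k + 1\<close> can follow exactly the words above
  \<open>(k+1)\<dots>(k+1)\<close>, and \<open>w (k+1)\<close> is the upper copy of \<open>w k\<close>, so admitting \<open>k + 1\<close> doubles the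
  interval of all \<open>w k\<close> with \<open>w\<close> above that word.\<close>

section \<open>Doublings and order isomorphisms\<close>

text \<open>When \<open>eq P\<close> is equality, the congruence axioms of the locale are trivial
  and only the three usual laws remain.\<close>

lemma partial_orderI:
  assumes "\<And>x. x \<in> carrier P \<Longrightarrow> x \<sqsubseteq>\<^bsub>P\<^esub> x"
    and "\<And>x y. \<lbrakk>x \<in> carrier P; y \<in> carrier P; x \<sqsubseteq>\<^bsub>P\<^esub> y; y \<sqsubseteq>\<^bsub>P\<^esub> x\<rbrakk> \<Longrightarrow> x = y"
    and "\<And>x y z. \<lbrakk>x \<in> carrier P; y \<in> carrier P; z \<in> carrier P; x \<sqsubseteq>\<^bsub>P\<^esub> y; y \<sqsubseteq>\<^bsub>P\<^esub> z\<rbrakk> \<Longrightarrow> x \<sqsubseteq>\<^bsub>P\<^esub> z"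
    and "eq P = (=)"
  shows "partial_order P"
  by unfold_locales (simp_all add: assms(1,4), (use assms(2) in blast), (use assms(3) in blast))

text \<open>Preserving and reflecting the order forces injectivity by antisymmetry, so of
  bijectivity only surjectivity has to be checked.\<close>

lemma order_isomorphicI:
  assumes A: "partial_order A" and B: "partial_order B"
    and img: "f ` carrier A = carrier B"
    and le: "\<And>x y. \<lbrakk>x \<in> carrier A; y \<in> carrier A\<rbrakk> \<Longrightarrow> f x \<sqsubseteq>\<^bsub>B\<^esub> f y \<longleftrightarrow> x \<sqsubseteq>\<^bsub>A\<^esub> y"
  shows "order_isomorphic A B"
proof -
  interpret A: partial_order A by fact
  interpret B: partial_order B by fact
  have "inj_on f (carrier A)"
    by (rule inj_onI) (metis A.le_antisym A.le_refl le)
  then show ?thesis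
    unfolding order_isomorphic_def order_emb_def bij_betw_def
    using A.weak_partial_order_axioms B.weak_partial_order_axioms img le by blast
qed

lemma order_isomorphic_trans:
  assumes "order_isomorphic A B" "order_isomorphic B C"
  shows "order_isomorphic A C"
proof -
  obtain f g where f: "order_emb A B f" "bij_betw f (carrier A) (carrier B)"
    and g: "order_emb B C g" "bij_betw g (carrier B) (carrier C)"
    using assms unfolding order_isomorphic_def by blast
  have "order_emb A C (g \<circ> f)"
    using f g bij_betwE[OF f(2)] unfolding order_emb_def by auto
  then show ?thesis
    unfolding order_isomorphic_def using bij_betw_trans[OF f(2) g(2)] by blast
qed

lemma doubling_le_iff [simp]:
  "(a, i) \<sqsubseteq>\<^bsub>doubling P X\<^esub> (b, j) \<longleftrightarrow> a \<sqsubseteq>\<^bsub>P\<^esub> b \<and> i \<le> j"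
  by (simp add: doubling_def)

lemma carrier_doublingD:
  "\<lbrakk>X \<subseteq> carrier P; (a, i) \<in> carrier (doubling P X)\<rbrakk> \<Longrightarrow> a \<in> carrier P"
  by (auto simp: doubling_def down_closure_def)

lemma partial_order_doubling:
  assumes "partial_order P" "X \<subseteq> carrier P"
  shows "partial_order (doubling P X)"
proof -
  interpret partial_order P by fact
  note sub = carrier_doublingD[OF assms(2)]
  show ?thesis
  proof (rule partial_orderI)
    fix u v w
    assume "u \<in> carrier (doubling P X)" "v \<in> carrier (doubling P X)" "w \<in> carrier (doubling P X)"
      "u \<sqsubseteq>\<^bsub>doubling P X\<^esub> v" "v \<sqsubseteq>\<^bsub>doubling P X\<^esub> w"
    then show "u \<sqsubseteq>\<^bsub>doubling P X\<^esub> w"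
      by (cases u; cases v; cases w) (simp, meson sub le_trans order_trans)
  next
    fix u v
    assume "u \<in> carrier (doubling P X)" "v \<in> carrier (doubling P X)"
      "u \<sqsubseteq>\<^bsub>doubling P X\<^esub> v" "v \<sqsubseteq>\<^bsub>doubling P X\<^esub> u"
    then show "u = v"
      by (cases u; cases v) (auto dest: sub le_antisym)
  next
    fix u
    assume "u \<in> carrier (doubling P X)"
    then show "u \<sqsubseteq>\<^bsub>doubling P X\<^esub> u"
      by (cases u) (auto dest: sub)
  qed (simp add: doubling_def)
qed

section \<open>Transport of posets and doublings along injections\<close>

lemma order_image_le_iff:
  assumes "inj_on f (carrier P)" "x \<in> carrier P" "y \<in> carrier P"
  shows "f x \<sqsubseteq>\<^bsub>order_image f P\<^esub> f y \<longleftrightarrow> x \<sqsubseteq>\<^bsub>P\<^esub> y"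
  using assms by (auto simp: order_image_def inj_on_eq_iff)

lemma partial_order_order_image:
  assumes "partial_order P" "inj_on f (carrier P)"
  shows "partial_order (order_image f P)"
proof -
  interpret partial_order P by fact
  have C: "carrier (order_image f P) = f ` carrier P" and E: "eq (order_image f P) = (=)"
    by (simp_all add: order_image_def)
  show ?thesis
    by (rule partial_orderI)
      (auto simp: C E order_image_le_iff[OF assms(2)] dest: le_antisym,
       (use le_trans in blast))
qed

lemma order_isomorphic_order_image:
  assumes "partial_order P" "inj_on f (carrier P)"
  shows "order_isomorphic P (order_image f P)"
  using assms
  by (intro order_isomorphicI[where f = f] partial_order_order_image)
    (auto simp: order_image_le_iff, simp_all add: order_image_def)

text \<open>The map \<open>f\<close> acts on the first coordinate and keeps the level. It carries
  the interval, its down-closure and the complement of that down-closure onto their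
  counterparts.\<close>

lemma order_isomorphic_doubling:
  assumes A: "partial_order A" and B: "partial_order B"
    and f: "order_emb A B f" "bij_betw f (carrier A) (carrier B)"
    and pq: "p \<in> carrier A" "q \<in> carrier A"
  shows "order_isomorphic (doubling A \<lbrace>p..q\<rbrace>\<^bsub>A\<^esub>) (doubling B \<lbrace>f p..f q\<rbrace>\<^bsub>B\<^esub>)"
proof -
  let ?X = "\<lbrace>p..q\<rbrace>\<^bsub>A\<^esub>" and ?Y = "\<lbrace>f p..f q\<rbrace>\<^bsub>B\<^esub>"
  have le: "f x \<sqsubseteq>\<^bsub>B\<^esub> f y \<longleftrightarrow> x \<sqsubseteq>\<^bsub>A\<^esub> y" if "x \<in> carrier A" "y \<in> carrier A" for x y
    using f(1) that by (simp add: order_emb_def)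
  have img: "carrier B = f ` carrier A" and inj: "inj_on f (carrier A)"
    using f(2) by (auto simp: bij_betw_def)
  have X: "?X \<subseteq> carrier A" "?Y \<subseteq> carrier B"
    by (auto simp: at_least_at_most_def)
  have Y: "?Y = f ` ?X"
    using pq by (auto simp: at_least_at_most_def img le)
  have D: "down_closure A ?X \<subseteq> carrier A"
    by (auto simp: down_closure_def)
  have "(\<exists>y\<in>?Y. f x \<sqsubseteq>\<^bsub>B\<^esub> y) \<longleftrightarrow> (\<exists>y\<in>?X. x \<sqsubseteq>\<^bsub>A\<^esub> y)" if "x \<in> carrier A" for x
    unfolding Y using X(1) le[OF that] by (simp add: subset_iff)
  then have dc: "down_closure B ?Y = f ` down_closure A ?X"
    unfolding down_closure_def img by blast
  \<comment> \<open>Injectivity of \<open>f\<close> lets the image commute with the set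
    difference.\<close>
  have diff: "carrier B - down_closure B ?Y = f ` (carrier A - down_closure A ?X)"
    unfolding dc img by (rule inj_on_image_set_diff[OF inj Diff_subset D, symmetric])
  show ?thesis
  proof (rule order_isomorphicI[where f = "map_prod f id"])
    show "map_prod f id ` carrier (doubling A ?X) = carrier (doubling B ?Y)"
      by (simp add: doubling_def diff) (simp add: dc[unfolded Y] Y image_Un map_prod_surj_on)
  next
    fix u v
    assume "u \<in> carrier (doubling A ?X)" "v \<in> carrier (doubling A ?X)"
    then show "map_prod f id u \<sqsubseteq>\<^bsub>doubling B ?Y\<^esub> map_prod f id v \<longleftrightarrow> u \<sqsubseteq>\<^bsub>doubling A ?X\<^esub> v"
      by (cases u; cases v) (simp add: le carrier_doublingD[OF X(1)])
  qed (rule partial_order_doubling[OF A X(1)], rule partial_order_doubling[OF B X(2)])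
qed

text \<open>The inductive definition speaks of bare relations; this supplies the partial order that
  the transport lemmas ask for.\<close>

lemma iterated_interval_doubling_partial_order:
  "iterated_interval_doubling P \<Longrightarrow> partial_order P"
proof (induction rule: iterated_interval_doubling.induct)
  case one_element
  show ?case by (rule partial_orderI) auto
next
  case (double P p q)
  then show ?case
    by (intro partial_order_order_image partial_order_doubling)
      (auto simp: at_least_at_most_def inj_on_def)
qed

text \<open>Interval-constructability of a poset that is not yet known to be a lattice.\<close>

definition doubling_constructable :: "'a gorder \<Rightarrow> bool" where
  "doubling_constructable L \<longleftrightarrow> (\<exists>P. iterated_interval_doubling P \<and> order_isomorphic L P)"

lemma doubling_constructable_iso:
  assumes "order_isomorphic L L'" "doubling_constructable L'"
  shows "doubling_constructable L"
  using assms order_isomorphic_trans unfolding doubling_constructable_def by blast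

lemma doubling_constructable_singleton:
  assumes "partial_order L" "carrier L = {a}"
  shows "doubling_constructable L"
proof -
  let ?P = "\<lparr>carrier = {Point}, eq = (=), le = (=)\<rparr>"
  interpret partial_order L by fact
  have "order_isomorphic L ?P"
    by (rule order_isomorphicI[where f = "\<lambda>_. Point"])
      (use assms le_refl in \<open>auto intro: partial_orderI\<close>)
  then show ?thesis
    unfolding doubling_constructable_def using one_element by blast
qed

text \<open>Pass to an isomorphic \<open>P\<close> over \<open>tower\<close>, double it along the
  image interval, and return to the type \<open>tower\<close> through \<open>Copy\<close>.\<close>

lemma doubling_constructable_doubling:
  assumes L: "partial_order L" and "doubling_constructable L"
    and pq: "p \<in> carrier L" "q \<in> carrier L" "p \<sqsubseteq>\<^bsub>L\<^esub> q"
  shows "doubling_constructable (doubling L \<lbrace>p..q\<rbrace>\<^bsub>L\<^esub>)"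
proof -
  obtain P f where P: "iterated_interval_doubling P"
    and f: "order_emb L P f" "bij_betw f (carrier L) (carrier P)"
    using assms(2) unfolding doubling_constructable_def order_isomorphic_def by blast
  have fpq: "f p \<in> carrier P" "f q \<in> carrier P" "f p \<sqsubseteq>\<^bsub>P\<^esub> f q"
    using f pq by (auto simp: order_emb_def bij_betw_def)
  have po: "partial_order P"
    by (rule iterated_interval_doubling_partial_order[OF P])
  let ?D = "doubling P \<lbrace>f p..f q\<rbrace>\<^bsub>P\<^esub>"
  have "order_isomorphic (doubling L \<lbrace>p..q\<rbrace>\<^bsub>L\<^esub>) ?D"
    by (rule order_isomorphic_doubling[OF L po f pq(1,2)])
  moreover have "order_isomorphic ?D (order_image Copy ?D)"
    by (intro order_isomorphic_order_image partial_order_doubling po)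
      (auto simp: at_least_at_most_def inj_on_def)
  ultimately show ?thesis
    unfolding doubling_constructable_def
    using order_isomorphic_trans iterated_interval_doubling.double[OF P fpq] by blast
qed

section \<open>Lists ordered componentwise\<close>

text \<open>An arbitrary carrier is allowed so that words and intermediate layers share one order
  and one proof that it is a partial order.\<close>

definition list_poset :: "nat list set \<Rightarrow> nat list gorder" where
  "list_poset S = \<lparr>carrier = S, eq = (=), le = list_all2 (\<le>)\<rparr>"

lemma carrier_list_poset [simp]: "carrier (list_poset S) = S"
  and le_list_poset [simp]: "le (list_poset S) = list_all2 (\<le>)"
  by (simp_all add: list_poset_def)

lemma list_all2_le_antisym:
  fixes u v :: "nat list"
  assumes "list_all2 (\<le>) u v" "list_all2 (\<le>) v u"
  shows "u = v"
  using assms by (auto simp: list_all2_conv_all_nth intro!: nth_equalityI intro: order_antisym)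

lemma partial_order_list_poset: "partial_order (list_poset S)"
  by (rule partial_orderI)
    (auto simp: list_poset_def list.rel_refl
      intro: list_all2_le_antisym list_all2_trans[OF order_trans])

lemma list_all2_replicate_le:
  "length w = n \<Longrightarrow> list_all2 (\<le>) (replicate n c) w \<longleftrightarrow> (\<forall>y\<in>set w. c \<le> y)"
  by (simp add: list_all2_conv_all_nth all_set_conv_all_nth)

lemma list_all2_snoc:
  "length u = length v \<Longrightarrow>
    list_all2 R (u @ [x]) (v @ [y]) \<longleftrightarrow> list_all2 R u v \<and> R x y"
  by (simp add: list_all2_append)

section \<open>The lattice of words\<close>

lemma W_eq_list_poset: "W m n = list_poset {w. mn_word m n w}"
  by (simp add: W_def list_poset_def)

text \<open>The letter 0 satisfies the inequalities of (MN2) trivially, so they can be stated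
  uniformly for all letters up to \<open>m\<close>. Within the alphabet, differing from
  \<open>m + 1\<close> means being at most \<open>m\<close>.\<close>

lemma mn_word_nth_iff:
  "mn_word m n w \<longleftrightarrow> length w = n \<and>
     (\<forall>i<n. w ! i \<le> m + 1) \<and> (0 < n \<longrightarrow> w ! 0 \<le> m) \<and>
     (\<forall>i<n. w ! i \<le> m \<longrightarrow> (\<forall>j<i. w ! i \<le> w ! j))"
proof -
  have "set w \<subseteq> {0..m + 1} \<longleftrightarrow> (\<forall>i<length w. w ! i \<le> m + 1)"
    by (auto simp: in_set_conv_nth subset_iff)
  moreover have "(\<forall>s i. 1 \<le> s \<and> s \<le> m \<and> i < n \<and> w ! i = s \<longrightarrow> (\<forall>j<i. s \<le> w ! j)) \<longleftrightarrow>
      (\<forall>i<n. w ! i \<le> m \<longrightarrow> (\<forall>j<i. w ! i \<le> w ! j))"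
  proof (intro iffI allI impI)
    fix i j
    assume "\<forall>s i. 1 \<le> s \<and> s \<le> m \<and> i < n \<and> w ! i = s \<longrightarrow> (\<forall>j<i. s \<le> w ! j)"
      and "i < n" "w ! i \<le> m" "j < i"
    then show "w ! i \<le> w ! j"
      by (cases "w ! i = 0") auto
  qed auto
  moreover have "(n \<ge> 1 \<longrightarrow> w ! 0 \<noteq> m + 1) \<longleftrightarrow> (0 < n \<longrightarrow> w ! 0 \<le> m)"
    if "\<forall>i<n. w ! i \<le> m + 1"
    using that[rule_format, of 0] by auto
  ultimately show ?thesis
    unfolding mn_word_def by blast
qed

section \<open>Finiteness, joins and meets\<close>

lemma finite_mn_words: "finite {w. mn_word m n w}"
  by (rule finite_subset[OF _ finite_lists_length_eq[of "{0..m + 1}" n]])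
    (auto simp: mn_word_def)

text \<open>If the maximum of two letters is at most \<open>m\<close>, then so are both letters;
  (MN2) applies in each word and passes to the maximum.\<close>

lemma mn_word_join:
  assumes "mn_word m n u" "mn_word m n v"
  shows "mn_word m n (map2 max u v)"
  using assms unfolding mn_word_nth_iff by (simp add: max.coboundedI1 max.coboundedI2)

text \<open>The componentwise minimum can break (MN2), since a letter up to \<open>m\<close> may
  come after a smaller one. Lowering each such letter to the minimum of its prefix repairs this;
  letters \<open>m + 1\<close> are not restricted by (MN2) and stay.\<close>

definition word_meet :: "nat \<Rightarrow> nat list \<Rightarrow> nat list \<Rightarrow> nat list" where
  "word_meet m u v = (let t = map2 min u v in
     map (\<lambda>i. if t ! i \<le> m then Min ((!) t ` {..i}) else t ! i) [0..<length t])"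

lemma word_meet_greatest:
  assumes u: "mn_word m n u" and v: "mn_word m n v"
  shows "mn_word m n (word_meet m u v)"
    and "list_all2 (\<le>) (word_meet m u v) u"
    and "list_all2 (\<le>) (word_meet m u v) v"
    and "\<lbrakk>mn_word m n w; list_all2 (\<le>) w u; list_all2 (\<le>) w v\<rbrakk>
      \<Longrightarrow> list_all2 (\<le>) w (word_meet m u v)"
proof -
  define t where "t = map2 min u v"
  define r where "r = word_meet m u v"
  have len: "length u = n" "length v = n" "length t = n"
    using u v by (auto simp: t_def mn_word_def)
  have t_nth: "t ! i = min (u ! i) (v ! i)" if "i < n" for i
    using that len by (simp add: t_def)
  have r_nth: "r ! i = (if t ! i \<le> m then Min ((!) t ` {..i}) else t ! i)" if "i < n" for i
    using that len by (simp add: r_def word_meet_def Let_def flip: t_def)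
  have len_r: "length r = n"
    using len by (simp add: r_def word_meet_def Let_def flip: t_def)
  have r_le: "r ! i \<le> t ! i" if "i < n" for i
    using that by (simp add: r_nth)
  have t_le: "t ! i \<le> m + 1" if "i < n" for i
    using u that by (auto simp: t_nth mn_word_nth_iff min_def)
  have r_mono: "r ! i \<le> r ! j" if "i < n" "r ! i \<le> m" "j < i" for i j
  proof -
    \<comment> \<open>A letter \<open>t ! i\<close> above \<open>m\<close> would be left unchanged,
      so \<open>r ! i\<close> would exceed \<open>m\<close> too.\<close>
    have "t ! i \<le> m"
      using that by (auto simp: r_nth split: if_splits)
    then have i: "r ! i = Min ((!) t ` {..i})"
      using that by (simp add: r_nth)
    have "Min ((!) t ` {..i}) \<le> Min ((!) t ` {..j})"
      using that by (intro Min_antimono) auto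
    \<comment> \<open>The letter \<open>r ! j\<close> is either a prefix minimum or
      \<open>t ! j\<close> itself, hence the two bounds.\<close>
    moreover have "Min ((!) t ` {..i}) \<le> t ! j"
      using that by simp
    ultimately show ?thesis
      using that i by (simp add: r_nth)
  qed
  have "r ! i \<le> m + 1" if "i < n" for i
    using r_le t_le that order_trans by blast
  moreover have "r ! 0 \<le> m" if "0 < n"
    using u that r_le[OF that] by (auto simp: t_nth mn_word_nth_iff)
  ultimately show "mn_word m n (word_meet m u v)"
    using r_mono len_r unfolding mn_word_nth_iff r_def by blast
  show "list_all2 (\<le>) (word_meet m u v) u" "list_all2 (\<le>) (word_meet m u v) v"
    using r_le len_r len by (auto simp: list_all2_conv_all_nth t_nth simp flip: r_def)
  assume w: "mn_word m n w" and le: "list_all2 (\<le>) w u" "list_all2 (\<le>) w v"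
  have w_t: "w ! i \<le> t ! i" if "i < n" for i
    using le that len by (simp add: list_all2_conv_all_nth t_nth)
  have "w ! i \<le> r ! i" if i: "i < n" for i
  proof (cases "t ! i \<le> m")
    case True
    \<comment> \<open>Since \<open>w ! i\<close> \<le> \<open>t ! i\<close> \<le> \<open>m\<close>,
      (MN2) applies to \<open>w\<close> at \<open>i\<close>. So \<open>w ! i\<close> is below every
      letter of the prefix of \<open>t\<close>, hence below its minimum.\<close>
    have "w ! i \<le> t ! j" if "j \<le> i" for j
    proof -
      have "w ! i \<le> w ! j"
        using w i that w_t[OF i] True by (cases "j = i") (auto simp: mn_word_nth_iff)
      also have "\<dots> \<le> t ! j"
        using i that by (intro w_t) simp
      finally show ?thesis .
    qed
    then show ?thesis
      using True i by (simp add: r_nth)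
  qed (use i w_t in \<open>simp add: r_nth\<close>)
  then show "list_all2 (\<le>) w (word_meet m u v)"
    using w len_r by (simp add: list_all2_conv_all_nth mn_word_def flip: r_def)
qed

lemma lattice_W: "Lattice.lattice (W m n)"
proof -
  have sup: "\<exists>s. least (W m n) s (Upper (W m n) {u, v})"
    if uv: "u \<in> carrier (W m n)" "v \<in> carrier (W m n)" for u v
  proof
    have U: "Upper (W m n) {u, v} = {w. mn_word m n w \<and> list_all2 (\<le>) u w \<and> list_all2 (\<le>) v w}"
      using uv by (auto simp: Upper_def W_eq_list_poset)
    have "length u = n" "length v = n"
      using uv by (simp_all add: W_eq_list_poset mn_word_def)
    then show "least (W m n) (map2 max u v) (Upper (W m n) {u, v})"
      using uv mn_word_join[of m n u v]
      by (simp add: U least_def) (auto simp: W_eq_list_poset list_all2_conv_all_nth)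
  qed
  have inf: "\<exists>s. greatest (W m n) s (Lower (W m n) {u, v})"
    if uv: "u \<in> carrier (W m n)" "v \<in> carrier (W m n)" for u v
  proof
    have L: "Lower (W m n) {u, v} = {w. mn_word m n w \<and> list_all2 (\<le>) w u \<and> list_all2 (\<le>) w v}"
      using uv by (auto simp: Lower_def W_eq_list_poset)
    show "greatest (W m n) (word_meet m u v) (Lower (W m n) {u, v})"
      using uv word_meet_greatest[of m n u v]
      by (simp add: L greatest_def) (auto simp: W_eq_list_poset)
  qed
  interpret partial_order "W m n"
    unfolding W_eq_list_poset by (rule partial_order_list_poset)
  show ?thesis
    by unfold_locales (fact sup inf)+
qed

section \<open>Appending a last letter\<close>

definition last_letters :: "nat \<Rightarrow> nat \<Rightarrow> nat list \<Rightarrow> nat set" where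
  "last_letters m k w = {x. x \<le> k \<and> (\<forall>y\<in>set w. x \<le> y)} \<union> (if w = [] then {} else {m + 1})"

text \<open>These posets interpolate: for \<open>0 < n\<close>, \<open>layer m n 0\<close> is two
  copies of \<open>W m n\<close>, one above the other, and \<open>layer m n m\<close> is
  \<open>W m (Suc n)\<close>.\<close>

definition layer :: "nat \<Rightarrow> nat \<Rightarrow> nat \<Rightarrow> nat list gorder" where
  "layer m n k = list_poset {w @ [x] |w x. mn_word m n w \<and> x \<in> last_letters m k w}"

lemma carrier_layer:
  "carrier (layer m n k) = {w @ [x] |w x. mn_word m n w \<and> x \<in> last_letters m k w}"
  and le_layer [simp]: "le (layer m n k) = list_all2 (\<le>)"
  by (simp_all add: layer_def)

lemma snoc_in_layer [simp]:
  "w @ [x] \<in> carrier (layer m n k) \<longleftrightarrow> mn_word m n w \<and> x \<in> last_letters m k w"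
  by (simp add: carrier_layer)

lemma partial_order_layer: "partial_order (layer m n k)"
  unfolding layer_def by (rule partial_order_list_poset)

text \<open>Both conditions look only at earlier letters, so appending a letter adds a constraint at
  the last position alone.\<close>

lemma mn_word_snoc:
  "mn_word m (Suc n) (w @ [x]) \<longleftrightarrow> mn_word m n w \<and> x \<in> last_letters m m w"
proof (cases "length w = n")
  case True
  have "(\<forall>y\<in>set w. x \<le> y) \<longleftrightarrow> (\<forall>j<n. x \<le> w ! j)"
    using True by (simp add: all_set_conv_all_nth)
  then show ?thesis
    using True
    by (cases "w = []")
      (auto simp: mn_word_nth_iff last_letters_def nth_append less_Suc_eq all_conj_distrib)
qed (simp add: mn_word_def)

lemma W_Suc_eq_layer: "W m (Suc n) = layer m n m"
proof -
  have "{w. mn_word m (Suc n) w} = {w @ [x] |w x. mn_word m n w \<and> x \<in> last_letters m m w}"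
  proof (rule Set.set_eqI)
    fix v
    show "v \<in> {w. mn_word m (Suc n) w} \<longleftrightarrow>
        v \<in> {w @ [x] |w x. mn_word m n w \<and> x \<in> last_letters m m w}"
      by (cases v rule: rev_cases) (auto simp: mn_word_snoc, simp add: mn_word_def)
  qed
  then show ?thesis
    by (simp add: W_eq_list_poset layer_def)
qed

section \<open>Endpoints of the intervals and the layers as doublings\<close>

definition top_word :: "nat \<Rightarrow> nat \<Rightarrow> nat list" where
  "top_word m n = map (\<lambda>i. if i = 0 then m else m + 1) [0..<n]"

lemma length_top_word [simp]: "length (top_word m n) = n"
  by (simp add: top_word_def)

lemma set_top_word_ge: "y \<in> set (top_word m n) \<Longrightarrow> m \<le> y"
  by (auto simp: top_word_def split: if_splits)

lemma mn_word_top_word: "mn_word m n (top_word m n)"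
  by (auto simp: mn_word_nth_iff top_word_def)

text \<open>(MN1) caps the first letter at \<open>m\<close>; the alphabet caps the others at
  \<open>m + 1\<close>.\<close>

lemma le_top_word: "mn_word m n w \<Longrightarrow> list_all2 (\<le>) w (top_word m n)"
  by (auto simp: mn_word_nth_iff top_word_def list_all2_conv_all_nth)

lemma mn_word_replicate: "c \<le> m \<Longrightarrow> mn_word m n (replicate n c)"
  by (auto simp: mn_word_nth_iff)

text \<open>The interval runs from the least word to the greatest, so it is all of
  \<open>W m n\<close> and the doubling is the product with the two-element chain.\<close>

lemma layer_0_iso:
  assumes "0 < n"
  shows "order_isomorphic (layer m n 0)
    (doubling (W m n) \<lbrace>replicate n 0..top_word m n\<rbrace>\<^bsub>W m n\<^esub>)"
proof -
  let ?X = "\<lbrace>replicate n 0..top_word m n\<rbrace>\<^bsub>W m n\<^esub>"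
  have X: "?X = carrier (W m n)"
    by (auto simp: at_least_at_most_def W_eq_list_poset le_top_word list_all2_replicate_le mn_word_def)
  interpret partial_order "W m n"
    unfolding W_eq_list_poset by (rule partial_order_list_poset)
  have D: "down_closure (W m n) (carrier (W m n)) = carrier (W m n)"
    by (auto simp: down_closure_def)
  have C: "carrier (doubling (W m n) ?X) = {w. mn_word m n w} \<times> {1, 2}"
    by (simp add: doubling_def X D) (auto simp: W_eq_list_poset)
  have L: "last_letters m 0 w = {0, m + 1}" if "mn_word m n w" for w
    using that assms by (auto simp: last_letters_def mn_word_def)
  \<comment> \<open>The last letter is \<open>0\<close> or \<open>m + 1\<close> and turns into level
    1 or 2.\<close>
  let ?f = "\<lambda>v. (butlast v, if last v = 0 then 1 else 2 :: nat)"
  show ?thesis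
  proof (rule order_isomorphicI[where f = ?f])
    show "partial_order (doubling (W m n) ?X)"
      by (rule partial_order_doubling) (auto simp: X partial_order_axioms)
    show "?f ` carrier (layer m n 0) = carrier (doubling (W m n) ?X)"
    proof (intro Set.set_eqI iffI)
      fix y assume "y \<in> carrier (doubling (W m n) ?X)"
      then obtain w i where y: "y = (w, i)" "mn_word m n w" "i = 1 \<or> i = 2"
        unfolding C by blast
      show "y \<in> ?f ` carrier (layer m n 0)"
        by (rule image_eqI[of _ _ "w @ [if i = 1 then 0 else m + 1]"]) (use y L in auto)
    qed (auto simp: C carrier_layer split: if_splits)
    show "?f u \<sqsubseteq>\<^bsub>doubling (W m n) ?X\<^esub> ?f v \<longleftrightarrow> u \<sqsubseteq>\<^bsub>layer m n 0\<^esub> v"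
      if "u \<in> carrier (layer m n 0)" "v \<in> carrier (layer m n 0)" for u v
      using that
      by (auto simp: carrier_layer L doubling_def W_eq_list_poset list_all2_snoc mn_word_def)
  qed (rule partial_order_layer)
qed

text \<open>As \<open>k < m\<close>, the constant word with letter \<open>Suc k\<close> is an
  (m,n)-word. All letters of both prefixes are at least \<open>k\<close>, so \<open>k\<close> can be
  appended.\<close>

lemma layer_Suc_interval:
  assumes "k < m"
  shows "replicate n (Suc k) @ [k] \<in> carrier (layer m n k)"
    and "top_word m n @ [k] \<in> carrier (layer m n k)"
    and "replicate n (Suc k) @ [k] \<sqsubseteq>\<^bsub>layer m n k\<^esub> top_word m n @ [k]"
  using assms le_top_word[OF mn_word_replicate[of "Suc k" m n]]
  by (auto simp: mn_word_replicate mn_word_top_word last_letters_def list_all2_snoc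
      dest: set_top_word_ge)

text \<open>Passing from stage \<open>k\<close> to \<open>Suc k\<close> adds just the words ending
  in \<open>Suc k\<close>, which are matched with the upper copies. For \<open>n = 0\<close> the
  interval is the single point \<open>[k]\<close>.\<close>

lemma layer_Suc_iso:
  assumes "k < m"
  shows "order_isomorphic (layer m n (Suc k))
    (doubling (layer m n k) \<lbrace>replicate n (Suc k) @ [k]..top_word m n @ [k]\<rbrace>\<^bsub>layer m n k\<^esub>)"
proof -
  let ?P = "layer m n k" and ?t = "top_word m n @ [k]"
  let ?X = "\<lbrace>replicate n (Suc k) @ [k]..?t\<rbrace>\<^bsub>layer m n k\<^esub>"
  have wlen: "length w = n" if "mn_word m n w" for w
    using that by (simp add: mn_word_def)
  \<comment> \<open>Both endpoints end in \<open>k\<close>, which forces \<open>x = k\<close>. The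
    upper one does not restrict \<open>w\<close>, because \<open>top_word m n\<close> is the
    greatest word.\<close>
  have X: "w @ [x] \<in> ?X \<longleftrightarrow> mn_word m n w \<and> x = k \<and> (\<forall>y\<in>set w. Suc k \<le> y)" for w x
  proof (cases "mn_word m n w")
    case True
    then have "w @ [x] \<in> ?X \<longleftrightarrow>
        x \<in> last_letters m k w \<and> (\<forall>y\<in>set w. Suc k \<le> y) \<and> k \<le> x \<and> x \<le> k"
      by (simp add: at_least_at_most_def wlen list_all2_snoc list_all2_replicate_le le_top_word)
    with True show ?thesis
      by (auto simp: last_letters_def Suc_leD)
  qed (simp add: at_least_at_most_def)
  have X_sub: "?X \<subseteq> carrier ?P"
    by (auto simp: at_least_at_most_def)
  have t: "?t \<in> ?X"
    using layer_Suc_interval[OF assms] by (simp add: at_least_at_most_def list_all2_refl)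
  \<comment> \<open>All elements of the interval end in \<open>k\<close>; conversely
    \<open>?t\<close> lies in it and dominates every word of the layer whose last letter is at most
    \<open>k\<close>.\<close>
  have D: "w @ [x] \<in> down_closure ?P ?X \<longleftrightarrow> w @ [x] \<in> carrier ?P \<and> x \<le> k" for w x
  proof
    assume "w @ [x] \<in> down_closure ?P ?X"
    then obtain y where y: "w @ [x] \<in> carrier ?P" "y \<in> ?X" "list_all2 (\<le>) (w @ [x]) y"
      by (auto simp: down_closure_def)
    moreover from y obtain w' x' where "y = w' @ [x']"
      using X_sub by (auto simp: carrier_layer)
    ultimately show "w @ [x] \<in> carrier ?P \<and> x \<le> k"
      by (auto simp: X list_all2_snoc wlen)
  next
    assume "w @ [x] \<in> carrier ?P \<and> x \<le> k"
    then show "w @ [x] \<in> down_closure ?P ?X"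
      by (auto simp: down_closure_def list_all2_snoc wlen le_top_word intro!: bexI[OF _ t])
  qed
  \<comment> \<open>The three cases are the lower copies, the words ending in \<open>m + 1\<close>
    (outside the down-closure), and the upper copies of the interval.\<close>
  have C: "(w @ [x], i) \<in> carrier (doubling ?P ?X) \<longleftrightarrow> mn_word m n w \<and>
      (x \<le> k \<and> (\<forall>y\<in>set w. x \<le> y) \<and> i = 1 \<or>
       w \<noteq> [] \<and> x = m + 1 \<and> i = 2 \<or>
       x = k \<and> (\<forall>y\<in>set w. Suc k \<le> y) \<and> i = 2)" for w x i
    using assms by (auto simp: doubling_def D X last_letters_def split: if_splits)
  have C_snoc: "\<exists>w x. v = w @ [x]" if "(v, i) \<in> carrier (doubling ?P ?X)" for v i
    using that X_sub by (auto simp: doubling_def down_closure_def carrier_layer)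
  \<comment> \<open>A word \<open>w @ [Suc k]\<close> goes to the upper copy of
    \<open>w @ [k]\<close>; all other words keep their letters, at level 2 exactly when they end in
    \<open>m + 1\<close>.\<close>
  let ?f = "\<lambda>v. (butlast v @ [if last v = Suc k then k else last v],
    if last v \<le> k then 1 else 2 :: nat)"
  show ?thesis
  proof (rule order_isomorphicI[where f = ?f])
    show "partial_order (doubling ?P ?X)"
      by (rule partial_order_doubling[OF partial_order_layer X_sub])
    show "?f ` carrier (layer m n (Suc k)) = carrier (doubling ?P ?X)"
    proof (intro Set.set_eqI iffI)
      fix y assume y: "y \<in> carrier (doubling ?P ?X)"
      then obtain w x i where y_eq: "y = (w @ [x], i)"
        using C_snoc by (metis surj_pair)
      show "y \<in> ?f ` carrier (layer m n (Suc k))"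
        by (rule image_eqI[of _ _ "w @ [if i = 2 \<and> x = k then Suc k else x]"])
          (use y assms in \<open>auto simp: y_eq C last_letters_def\<close>)
    next
      fix y assume "y \<in> ?f ` carrier (layer m n (Suc k))"
      then obtain w x where "mn_word m n w" "x \<in> last_letters m (Suc k) w" "y = ?f (w @ [x])"
        by (auto simp: carrier_layer)
      then show "y \<in> carrier (doubling ?P ?X)"
        using assms by (auto simp: C last_letters_def le_Suc_eq split: if_splits)
    qed
    fix u v
    assume "u \<in> carrier (layer m n (Suc k))" "v \<in> carrier (layer m n (Suc k))"
    then obtain w x w' x' where uv: "u = w @ [x]" "v = w' @ [x']"
      and w: "mn_word m n w" "mn_word m n w'"
      and x: "x \<in> last_letters m (Suc k) w" "x' \<in> last_letters m (Suc k) w'"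
      unfolding carrier_layer by blast
    \<comment> \<open>With these bounds and \<open>k < m\<close>, comparing images reduces to cases
      on whether each last letter is at most \<open>k\<close>, \<open>Suc k\<close> or
      \<open>m + 1\<close>.\<close>
    have "x \<le> Suc k \<or> x = m + 1" "x' \<le> Suc k \<or> x' = m + 1"
      using x by (auto simp: last_letters_def split: if_splits)
    then show "?f u \<sqsubseteq>\<^bsub>doubling ?P ?X\<^esub> ?f v \<longleftrightarrow> u \<sqsubseteq>\<^bsub>layer m n (Suc k)\<^esub> v"
      using wlen[OF w(1)] wlen[OF w(2)] assms by (auto simp: uv list_all2_snoc)
  qed (rule partial_order_layer)
qed

lemma doubling_constructable_layer:
  assumes "doubling_constructable (W m n)" "k \<le> m"
  shows "doubling_constructable (layer m n k)"
  using assms(2)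
proof (induction k)
  case 0
  show ?case
  proof (cases "n = 0")
    case True
    \<comment> \<open>At stage 0 only \<open>0\<close> can follow the empty word, so the layer is a
      point rather than a doubling of \<open>W m 0\<close>.\<close>
    have "carrier (layer m 0 0) = {[0]}"
      by (auto simp: carrier_layer mn_word_def last_letters_def)
    then show ?thesis
      using True doubling_constructable_singleton[OF partial_order_layer] by simp
  next
    case False
    have interval: "replicate n 0 \<in> carrier (W m n)" "top_word m n \<in> carrier (W m n)"
      "replicate n 0 \<sqsubseteq>\<^bsub>W m n\<^esub> top_word m n"
      by (simp_all add: W_eq_list_poset mn_word_replicate mn_word_top_word le_top_word)
    have "partial_order (W m n)"
      by (simp add: W_eq_list_poset partial_order_list_poset)
    from doubling_constructable_doubling[OF this assms(1) interval]
    show ?thesis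
      using doubling_constructable_iso[OF layer_0_iso] False by blast
  qed
next
  case (Suc k)
  then have k: "k < m" and IH: "doubling_constructable (layer m n k)"
    by simp_all
  show ?case
    using doubling_constructable_iso[OF layer_Suc_iso[OF k]]
      doubling_constructable_doubling[OF partial_order_layer IH layer_Suc_interval[OF k]] .
qed

text \<open>The layers lead from \<open>W m n\<close> up to \<open>layer m n m\<close>, which is
  \<open>W m (Suc n)\<close>; the empty word starts the induction.\<close>

lemma doubling_constructable_W: "doubling_constructable (W m n)"
proof (induction n)
  case 0
  have "carrier (W m 0) = {[]}"
    by (auto simp: W_def mn_word_def)
  then show ?case
    by (rule doubling_constructable_singleton[rotated])
      (simp add: W_eq_list_poset partial_order_list_poset)
next
  case (Suc n)
  then show ?case
    by (simp add: W_Suc_eq_layer doubling_constructable_layer)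
qed

theorem theorem4p3:
  fixes m n :: nat
  shows "interval_constructable (W m n)"
  using doubling_constructable_W[of m n] lattice_W[of m n] finite_mn_words[of m n]
  by (simp add: interval_constructable_def doubling_constructable_def W_eq_list_poset)

end
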